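(* The strict lower bound $\nu>\rho-\min\{d_i\}+1$ for irreducibility of all multivariate subresultants in degree $\nu$ is sharp, in the following sense: there exist integers $n\ge 2$ and $d_1,\dots,d_n\ge 1$ and, for $\nu:=\rho-\min\{d_i\}+1$ with $\rho:=\sum_{i=1}^n(d_i-1)$, a set $S$ of monomials of degree $\nu$ in $x_1,\dots,x_n$ of cardinality $H_{d_1,\dots,d_n}(\nu)$, such that the subresultant $\Delta_S^\nu(P_1,\dots,P_n)$ of the generic homogeneous polynomials $P_1,\dots,P_n$ of degrees $d_1,\dots,d_n$ is not irreducible in $A$.
   Context: For $i=1,\dots,n$ and $\alpha\in\mathbb{Z}_{\ge 0}^n$ with $|\alpha|=d_i$ let $c_{i,\alpha}$ be an independent variable, let $A:=\mathbb{Z}[c_{i,\alpha} : i=1,\dots,n,\ |\alpha|=d_i]$, and let $P_i(x_1,\dots,x_n):=\sum_{|\alpha|=d_i}c_{i,\alpha}x^\alpha$. For integers $e_1,\dots,e_s\ge 1$ with $s\le n$, $H_{e_1,\dots,e_s}(t)$ denotes the Hilbert function in degree $t$ of a complete intersection given by $s$ homogeneous polynomials of degrees $e_1,\dots,e_s$ in $n$ variables, i.e. the coefficient of $T^t$ in $\prod_{j=1}^s(1-T^{e_j})/(1-T)^n$ (so it is $0$ for $t<0$). Multivariate subresultant (Chardin): let $S$ be a set of $H_{d_1,\dots,d_n}(\nu)$ monomials of degree $\nu$ in $x_1,\dots,x_n$. The subresultant $\Delta_S^\nu=\Delta_S^\nu(P_1,\dots,P_n)\in A$ is a polynomial with integer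 coefficients in the coefficients $c_{i,\alpha}$, considered up to sign, which is homogeneous of degree $H_{d_1,\dots,d_{i-1},d_{i+1},\dots,d_n}(\nu-d_i)$ in the coefficients of $P_i$ for each $i=1,\dots,n$, and which has the following universal property: for every field $\mathbb{K}$ and every specialization of the $c_{i,\alpha}$ in $\mathbb{K}$ (sending $P_i$ to a polynomial in $\mathbb{K}[x_1,\dots,x_n]$, still denoted $P_i$), the specialized value of $\Delta_S^\nu$ is nonzero if and only if $I_\nu+\mathbb{K}\langle S\rangle=\mathbb{K}[x_1,\dots,x_n]_\nu$, where $I_\nu$ is the degree $\nu$ part of the ideal generated by the specialized $P_1,\dots,P_n$ and $\mathbb{K}\langle S\rangle$ is the $\mathbb{K}$-span of $S$. *)

theory Defs
  imports
    "HOL-Algebra.Algebra"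
    "HOL-Library.Poly_Mapping"
    "HOL-Computational_Algebra.Formal_Power_Series"
begin

text \<open>
  A monomial in \<open>x\<^sub>0, x\<^sub>1, \<dots>\<close> is identified with its exponent vector, of type
  \<open>nat \<Rightarrow>\<^sub>0 nat\<close>. The variables and the polynomials \<open>P\<^sub>i\<close> are indexed by \<open>i < n\<close>.
\<close>

type_synonym exponent = "nat \<Rightarrow>\<^sub>0 nat"

definition mdeg :: "exponent \<Rightarrow> nat" where
  "mdeg \<alpha> = (\<Sum>j\<in>Poly_Mapping.keys \<alpha>. Poly_Mapping.lookup \<alpha> j)"

definition monomials :: "nat \<Rightarrow> nat \<Rightarrow> exponent set" where
  "monomials n t = {\<alpha>. Poly_Mapping.keys \<alpha> \<subseteq> {..<n} \<and> mdeg \<alpha> = t}"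


subsection \<open>The ring of generic coefficients\<close>

text \<open>The pair \<open>(i, \<alpha>)\<close> is the index of the variable \<open>c\<^sub>i\<^sub>,\<^sub>\<alpha>\<close>.\<close>

type_synonym coeff_poly = "((nat \<times> exponent) \<Rightarrow>\<^sub>0 nat) \<Rightarrow>\<^sub>0 int"

definition coeff_indices :: "nat \<Rightarrow> (nat \<Rightarrow> nat) \<Rightarrow> (nat \<times> exponent) set" where
  "coeff_indices n d = {(i, \<alpha>). i < n \<and> \<alpha> \<in> monomials n (d i)}"

definition coeff_ring :: "nat \<Rightarrow> (nat \<Rightarrow> nat) \<Rightarrow> coeff_poly ring" where
  "coeff_ring n d =
     \<lparr>carrier = {p. \<forall>m\<in>Poly_Mapping.keys p. Poly_Mapping.keys m \<subseteq> coeff_indices n d},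
      monoid.mult = (*), one = 1, ring.zero = 0, add = (+)\<rparr>"

definition coeff_var :: "nat \<Rightarrow> exponent \<Rightarrow> coeff_poly" where
  "coeff_var i \<alpha> = Poly_Mapping.single (Poly_Mapping.single (i, \<alpha>) 1) 1"

text \<open>
  Homogeneity of degree \<open>k\<close> in the variables \<open>c\<^sub>i\<^sub>,\<^sub>\<alpha>\<close> for one fixed \<open>i\<close>. As usual, the zero
  polynomial is homogeneous of every degree. The degree is rational only because the values
  of \<open>ci_hilbert\<close> below are.
\<close>

definition homogeneous_in :: "nat \<Rightarrow> rat \<Rightarrow> coeff_poly \<Rightarrow> bool" where
  "homogeneous_in i k p \<longleftrightarrow>
     (\<forall>m\<in>Poly_Mapping.keys p.
        of_nat (\<Sum>v\<in>{v \<in> Poly_Mapping.keys m. fst v = i}. Poly_Mapping.lookup m v) = k)"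


subsection \<open>Hilbert functions of complete intersections\<close>

text \<open>
  The degrees are \<open>e j\<close> for \<open>j \<in> J\<close>. The power series are taken over the rationals so that
  the library division of power series applies.
\<close>

definition ci_hilbert :: "nat \<Rightarrow> (nat \<Rightarrow> nat) \<Rightarrow> nat set \<Rightarrow> int \<Rightarrow> rat" where
  "ci_hilbert n e J t =
     (if t < 0 then 0
      else fps_nth ((\<Prod>j\<in>J. 1 - fps_X ^ e j) / (1 - fps_X) ^ n) (nat t))"


subsection \<open>Polynomial rings over an arbitrary field\<close>

text \<open>
  \<open>mpoly_ring K n\<close> is \<open>K[x\<^sub>0, \<dots>, x\<^sub>n\<^sub>-\<^sub>1]\<close>. The coefficient ring \<open>K\<close> is a record and not a
  type of class \<open>field\<close>, because the definition of subresultants quantifies over all fields.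
\<close>

definition mpoly_ring :: "'k ring \<Rightarrow> nat \<Rightarrow> (exponent \<Rightarrow> 'k) ring" where
  "mpoly_ring K n =
     \<lparr>carrier = {f. (\<forall>\<alpha>. f \<alpha> \<in> carrier K) \<and> finite {\<alpha>. f \<alpha> \<noteq> \<zero>\<^bsub>K\<^esub>} \<and>
                    (\<forall>\<alpha>. f \<alpha> \<noteq> \<zero>\<^bsub>K\<^esub> \<longrightarrow> Poly_Mapping.keys \<alpha> \<subseteq> {..<n})},
      monoid.mult = (\<lambda>f g \<alpha>. \<Oplus>\<^bsub>K\<^esub>p\<in>{(\<beta>, \<gamma>). \<beta> + \<gamma> = \<alpha>}. f (fst p) \<otimes>\<^bsub>K\<^esub> g (snd p)),
      one = (\<lambda>\<alpha>. if \<alpha> = 0 then \<one>\<^bsub>K\<^esub> else \<zero>\<^bsub>K\<^esub>),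
      ring.zero = (\<lambda>\<alpha>. \<zero>\<^bsub>K\<^esub>),
      add = (\<lambda>f g \<alpha>. f \<alpha> \<oplus>\<^bsub>K\<^esub> g \<alpha>)\<rparr>"

definition degree_part :: "'k ring \<Rightarrow> nat \<Rightarrow> nat \<Rightarrow> (exponent \<Rightarrow> 'k) set" where
  "degree_part K n t =
     {f \<in> carrier (mpoly_ring K n). \<forall>\<alpha>. f \<alpha> \<noteq> \<zero>\<^bsub>K\<^esub> \<longrightarrow> mdeg \<alpha> = t}"

text \<open>The linear combination \<open>\<Sum>\<alpha>\<in>M. c \<alpha> x\<^sup>\<alpha>\<close>.\<close>

definition lin_comb :: "'k ring \<Rightarrow> exponent set \<Rightarrow> (exponent \<Rightarrow> 'k) \<Rightarrow> (exponent \<Rightarrow> 'k)" where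
  "lin_comb K M c = (\<lambda>\<alpha>. if \<alpha> \<in> M then c \<alpha> else \<zero>\<^bsub>K\<^esub>)"

definition monomial_span :: "'k ring \<Rightarrow> exponent set \<Rightarrow> (exponent \<Rightarrow> 'k) set" where
  "monomial_span K S = {lin_comb K S c | c. c \<in> S \<rightarrow> carrier K}"


subsection \<open>Specializations and subresultants\<close>

text \<open>A specialization of the \<open>c\<^sub>i\<^sub>,\<^sub>\<alpha>\<close> in \<open>K\<close> is a ring homomorphism \<open>\<phi>\<close> from the coefficient ring.\<close>

definition spec_poly ::
  "'k ring \<Rightarrow> nat \<Rightarrow> (nat \<Rightarrow> nat) \<Rightarrow> (coeff_poly \<Rightarrow> 'k) \<Rightarrow> nat \<Rightarrow> (exponent \<Rightarrow> 'k)" where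
  "spec_poly K n d \<phi> i = lin_comb K (monomials n (d i)) (\<lambda>\<alpha>. \<phi> (coeff_var i \<alpha>))"

definition spec_ideal ::
  "'k ring \<Rightarrow> nat \<Rightarrow> (nat \<Rightarrow> nat) \<Rightarrow> (coeff_poly \<Rightarrow> 'k) \<Rightarrow> (exponent \<Rightarrow> 'k) set" where
  "spec_ideal K n d \<phi> = genideal (mpoly_ring K n) (spec_poly K n d \<phi> ` {..<n})"

text \<open>
  \<open>is_subresultant TYPE('k) n d \<nu> S \<Delta>\<close> states that \<open>\<Delta>\<close> has the degrees and the universal
  property of the subresultant \<open>\<Delta>\<^sub>S\<^sup>\<nu>(P\<^sub>1, \<dots>, P\<^sub>n)\<close>; it does not distinguish \<open>\<Delta>\<close> from \<open>-\<Delta>\<close>. HOL has no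
  quantification over types, so "every field" is every field whose carrier is a set of
  elements of \<open>'k\<close>. For every infinite \<open>'k\<close> this amounts to all fields: the universal property
  for a specialization is equivalent to that for its corestriction to the subfield generated
  by the image, which is countable.
\<close>

definition is_subresultant ::
  "'k itself \<Rightarrow> nat \<Rightarrow> (nat \<Rightarrow> nat) \<Rightarrow> nat \<Rightarrow> exponent set \<Rightarrow> coeff_poly \<Rightarrow> bool" where
  "is_subresultant _ n d \<nu> S \<Delta> \<longleftrightarrow>
     \<Delta> \<in> carrier (coeff_ring n d) \<and>
     (\<forall>i<n. homogeneous_in i (ci_hilbert n d ({..<n} - {i}) (int \<nu> - int (d i))) \<Delta>) \<and>
     (\<forall>(K :: 'k ring) \<phi>. field K \<longrightarrow> \<phi> \<in> ring_hom (coeff_ring n d) K \<longrightarrow>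
        (\<phi> \<Delta> \<noteq> \<zero>\<^bsub>K\<^esub> \<longleftrightarrow>
         set_add (mpoly_ring K n) (spec_ideal K n d \<phi> \<inter> degree_part K n \<nu>) (monomial_span K S)
           = degree_part K n \<nu>))"

end

theory Submission
  imports Defs "HOL-Library.Countable"
begin

text \<open>
  Take \<open>n = 2\<close> and degrees \<open>1, 3\<close>, so that \<open>\<nu> = 2\<close>, and let \<open>P\<^sub>0 = a x\<^sub>0 + b x\<^sub>1\<close>. In degree 2 the ideal is
  spanned by \<open>x\<^sub>0 P\<^sub>0\<close> and \<open>x\<^sub>1 P\<^sub>0\<close>, because \<open>P\<^sub>1\<close> has degree 3. For \<open>S = {x\<^sub>0\<^sup>2}\<close> the complement condition
  says that the coefficients of \<open>x\<^sub>0 x\<^sub>1, x\<^sub>1\<^sup>2\<close> in these two products form an invertible matrix, which is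
  triangular with determinant \<open>b\<^sup>2\<close>. So \<open>b\<^sup>2\<close> is a subresultant. Any other subresultant is a quadratic
  form \<open>p a\<^sup>2 + q a b + r b\<^sup>2\<close>, and specializing \<open>a = 1, b = 0\<close> in a copy of the rationals inside
  \<open>'k\<close> gives \<open>p = 0\<close>; hence it is divisible by \<open>b\<close>.
\<close>

section \<open>Polynomials over a commutative ring\<close>

lemma (in abelian_monoid) finsum_mono_neutral_right:
  assumes "finite B" "A \<subseteq> B" "\<And>i. i \<in> B - A \<Longrightarrow> g i = \<zero>" "\<And>i. i \<in> B \<Longrightarrow> g i \<in> carrier G"
  shows "finsum G g B = finsum G g A"
proof -
  have "finsum G g (A \<union> (B - A)) = finsum G g A \<oplus> finsum G g (B - A)"
    using assms by (intro finsum_Un_disjoint) (auto intro: finite_subset)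
  moreover have "finsum G g (B - A) = \<zero>"
    using assms by (intro add.finprod_one_eqI) auto
  moreover have "finsum G g A \<in> carrier G"
    using assms by (intro finsum_closed) auto
  moreover have "A \<union> (B - A) = B" using assms by auto
  ultimately show ?thesis by simp
qed

text \<open>Tagging each inner index with its outer index by \<open>Pair i\<close> makes the inner
  index sets disjoint. This flattens the nested sums that arise in associativity of
  multiplication.\<close>

lemma (in abelian_monoid) finsum_Sigma:
  assumes "finite I" "\<And>i. i \<in> I \<Longrightarrow> finite (A i)"
    and "\<And>i j. i \<in> I \<Longrightarrow> j \<in> A i \<Longrightarrow> f i j \<in> carrier G"
  shows "(\<Oplus>i\<in>I. \<Oplus>j\<in>A i. f i j) = (\<Oplus>p\<in>Sigma I A. f (fst p) (snd p))"
proof -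
  have "(\<Oplus>p\<in>Sigma I A. f (fst p) (snd p)) = (\<Oplus>p\<in>(\<Union>i\<in>I. Pair i ` A i). f (fst p) (snd p))"
    by (rule arg_cong[where f = "finsum G _"]) auto
  also have "\<dots> = (\<Oplus>i\<in>I. \<Oplus>p\<in>Pair i ` A i. f (fst p) (snd p))"
    by (rule add.finprod_UN_disjoint) (use assms in \<open>auto simp: pairwise_def disjnt_def\<close>)
  also have "\<dots> = (\<Oplus>i\<in>I. \<Oplus>j\<in>A i. f i j)"
  proof (intro add.finprod_cong' refl)
    fix i assume "i \<in> I"
    then show "(\<Oplus>p\<in>Pair i ` A i. f (fst p) (snd p)) = (\<Oplus>j\<in>A i. f i j)"
      using assms(3) by (subst finsum_reindex) (auto simp: inj_on_def)
  qed (use assms in \<open>auto intro!: finsum_closed\<close>)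
  finally show ?thesis by simp
qed

text \<open>The index set of the convolution in \<open>mpoly_ring\<close>. Its finiteness matters
  because \<open>finsum\<close> over an infinite set is zero by default.\<close>

definition splits :: "exponent \<Rightarrow> (exponent \<times> exponent) set" where
  "splits \<alpha> = {(\<beta>, \<gamma>). \<beta> + \<gamma> = \<alpha>}"

text \<open>Each summand of \<alpha> is bounded by \<alpha> coordinatewise. So it vanishes off the
  keys of \<alpha> and is at most the largest exponent of \<alpha> on them, which leaves finitely
  many functions.\<close>

lemma finite_splits: "finite (splits \<alpha>)"
proof -
  let ?k = "Poly_Mapping.keys \<alpha>" and ?l = "Poly_Mapping.lookup"
  let ?F = "{f. \<forall>x. (x \<in> ?k \<longrightarrow> f x \<in> {..Max (?l \<alpha> ` ?k)}) \<and> (x \<notin> ?k \<longrightarrow> f x = (0::nat))}"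
  let ?B = "{\<beta>. ?l \<beta> \<in> ?F}"
  have "finite ?F"
    by (rule finite_set_of_finite_funs) auto
  moreover have "inj ?l"
    by (rule injI) (simp add: poly_mapping.lookup_inject)
  ultimately have fin: "finite ?B"
    using finite_vimageI[of ?F ?l] by (simp add: vimage_def)
  have sub: "\<beta> \<in> ?B" if "\<beta> + \<gamma> = \<alpha>" for \<beta> \<gamma>
  proof -
    have le: "?l \<beta> x \<le> ?l \<alpha> x" for x
      using that by (auto simp: lookup_add)
    have "?l \<beta> x \<le> Max (?l \<alpha> ` ?k)" if "x \<in> ?k" for x
      by (rule order_trans[OF le Max_ge]) (use that in auto)
    moreover have "?l \<beta> x = 0" if "x \<notin> ?k" for x
      using le[of x] that by (simp add: in_keys_iff)
    ultimately show ?thesis by auto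
  qed
  have "splits \<alpha> \<subseteq> ?B \<times> ?B"
  proof
    fix p assume "p \<in> splits \<alpha>"
    \<comment> \<open>The bound \<open>sub\<close> concerns the first summand; the commuted equation
      yields it for the second.\<close>
    then have "fst p + snd p = \<alpha>" "snd p + fst p = \<alpha>"
      by (auto simp: splits_def add.commute)
    then have "fst p \<in> ?B" "snd p \<in> ?B"
      using sub by blast+
    then show "p \<in> ?B \<times> ?B"
      by (simp only: mem_Times_iff)
  qed
  then show ?thesis
    using finite_cartesian_product[OF fin fin] by (rule finite_subset)
qed

section \<open>The ring axioms for polynomials\<close>

lemma mpoly_ring_carrier:
  "f \<in> carrier (mpoly_ring K n) \<longleftrightarrow>
     (\<forall>\<alpha>. f \<alpha> \<in> carrier K) \<and> finite {\<alpha>. f \<alpha> \<noteq> \<zero>\<^bsub>K\<^esub>} \<and>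
     (\<forall>\<alpha>. f \<alpha> \<noteq> \<zero>\<^bsub>K\<^esub> \<longrightarrow> Poly_Mapping.keys \<alpha> \<subseteq> {..<n})"
  by (simp add: mpoly_ring_def)

lemma mpoly_ring_mult:
  "f \<otimes>\<^bsub>mpoly_ring K n\<^esub> g =
     (\<lambda>\<alpha>. \<Oplus>\<^bsub>K\<^esub>p\<in>splits \<alpha>. f (fst p) \<otimes>\<^bsub>K\<^esub> g (snd p))"
  by (simp add: mpoly_ring_def splits_def)

lemma mpoly_ring_add: "f \<oplus>\<^bsub>mpoly_ring K n\<^esub> g = (\<lambda>\<alpha>. f \<alpha> \<oplus>\<^bsub>K\<^esub> g \<alpha>)"
  by (simp add: mpoly_ring_def)

lemma mpoly_ring_zero: "\<zero>\<^bsub>mpoly_ring K n\<^esub> = (\<lambda>\<alpha>. \<zero>\<^bsub>K\<^esub>)"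
  by (simp add: mpoly_ring_def)

lemma mpoly_ring_one: "\<one>\<^bsub>mpoly_ring K n\<^esub> = (\<lambda>\<alpha>. if \<alpha> = 0 then \<one>\<^bsub>K\<^esub> else \<zero>\<^bsub>K\<^esub>)"
  by (simp add: mpoly_ring_def)

text \<open>\<open>mpoly_ring\<close> accepts only records of type \<open>'k ring\<close>, without extension fields.\<close>

locale coeff_cring = cring R for R :: "'k ring" (structure)
begin

lemma mpoly_coeff_closed: "f \<in> carrier (mpoly_ring R n) \<Longrightarrow> f \<alpha> \<in> carrier R"
  by (simp add: mpoly_ring_carrier)

lemma mpoly_add_closed:
  assumes "f \<in> carrier (mpoly_ring R n)" "g \<in> carrier (mpoly_ring R n)"
  shows "f \<oplus>\<^bsub>mpoly_ring R n\<^esub> g \<in> carrier (mpoly_ring R n)"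
proof -
  have nz: "f \<alpha> \<noteq> \<zero> \<or> g \<alpha> \<noteq> \<zero>" if "f \<alpha> \<oplus> g \<alpha> \<noteq> \<zero>" for \<alpha>
    using that by auto
  have "{\<alpha>. f \<alpha> \<oplus> g \<alpha> \<noteq> \<zero>} \<subseteq> {\<alpha>. f \<alpha> \<noteq> \<zero>} \<union> {\<alpha>. g \<alpha> \<noteq> \<zero>}"
    using nz by auto
  then have "finite {\<alpha>. f \<alpha> \<oplus> g \<alpha> \<noteq> \<zero>}"
    using assms by (auto simp: mpoly_ring_carrier intro: finite_subset)
  then show ?thesis
    using assms nz by (simp add: mpoly_ring_carrier mpoly_ring_add) blast
qed

text \<open>If every term of the convolution at \<alpha> were zero, so would be the sum. This
  confines the support of a product to sums of support elements, hence gives its finiteness and the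
  bound on its variables.\<close>

lemma mpoly_mult_nonzeroE:
  assumes "f \<in> carrier (mpoly_ring R n)" "g \<in> carrier (mpoly_ring R n)"
    and "(f \<otimes>\<^bsub>mpoly_ring R n\<^esub> g) \<alpha> \<noteq> \<zero>"
  obtains \<beta> \<gamma> where "\<alpha> = \<beta> + \<gamma>" "f \<beta> \<noteq> \<zero>" "g \<gamma> \<noteq> \<zero>"
proof -
  have "\<exists>p\<in>splits \<alpha>. f (fst p) \<otimes> g (snd p) \<noteq> \<zero>"
    using assms(3) add.finprod_one_eqI[of "splits \<alpha>" "\<lambda>p. f (fst p) \<otimes> g (snd p)"]
    by (auto simp: mpoly_ring_mult)
  then obtain \<beta> \<gamma> where "\<beta> + \<gamma> = \<alpha>" "f \<beta> \<otimes> g \<gamma> \<noteq> \<zero>"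
    by (auto simp: splits_def)
  then show ?thesis
    using assms(1,2) that[of \<beta> \<gamma>] by (metis l_null r_null mpoly_coeff_closed)
qed

lemma mpoly_mult_closed:
  assumes f: "f \<in> carrier (mpoly_ring R n)" and g: "g \<in> carrier (mpoly_ring R n)"
  shows "f \<otimes>\<^bsub>mpoly_ring R n\<^esub> g \<in> carrier (mpoly_ring R n)"
proof -
  let ?h = "f \<otimes>\<^bsub>mpoly_ring R n\<^esub> g"
  have "{\<alpha>. ?h \<alpha> \<noteq> \<zero>} \<subseteq> (\<lambda>(\<beta>, \<gamma>). \<beta> + \<gamma>) ` ({\<beta>. f \<beta> \<noteq> \<zero>} \<times> {\<gamma>. g \<gamma> \<noteq> \<zero>})"
    by (auto elim!: mpoly_mult_nonzeroE[OF f g])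
  then have "finite {\<alpha>. ?h \<alpha> \<noteq> \<zero>}"
    by (rule finite_subset) (use f g in \<open>auto simp: mpoly_ring_carrier\<close>)
  moreover have "?h \<alpha> \<in> carrier R" for \<alpha>
    unfolding mpoly_ring_mult by (rule finsum_closed) (use f g in \<open>auto simp: mpoly_coeff_closed\<close>)
  moreover have "Poly_Mapping.keys \<alpha> \<subseteq> {..<n}" if nz: "?h \<alpha> \<noteq> \<zero>" for \<alpha>
  proof -
    obtain \<beta> \<gamma> where "\<alpha> = \<beta> + \<gamma>" "f \<beta> \<noteq> \<zero>" "g \<gamma> \<noteq> \<zero>"
      using mpoly_mult_nonzeroE[OF f g nz] .
    then show ?thesis
      using keys_add[of \<beta> \<gamma>] f g unfolding mpoly_ring_carrier by blast
  qed
  ultimately show ?thesis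
    by (auto simp: mpoly_ring_carrier)
qed

text \<open>Both sides sum over all ways to write \<alpha> as a sum of three exponents.
  \<open>?L\<close> and \<open>?R\<close> encode these triples with the two bracketings, and
  \<open>?r\<close> is the rebracketing bijection between them.\<close>

lemma mpoly_mult_assoc:
  assumes f: "f \<in> carrier (mpoly_ring R n)" and g: "g \<in> carrier (mpoly_ring R n)"
    and h: "h \<in> carrier (mpoly_ring R n)"
  shows "f \<otimes>\<^bsub>mpoly_ring R n\<^esub> g \<otimes>\<^bsub>mpoly_ring R n\<^esub> h = f \<otimes>\<^bsub>mpoly_ring R n\<^esub> (g \<otimes>\<^bsub>mpoly_ring R n\<^esub> h)"
proof
  fix \<alpha>
  note cl = mpoly_coeff_closed[OF f] mpoly_coeff_closed[OF g] mpoly_coeff_closed[OF h]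
  let ?L = "SIGMA p:splits \<alpha>. splits (fst p)" and ?R = "SIGMA p:splits \<alpha>. splits (snd p)"
  let ?r = "\<lambda>(p, q). ((fst q, snd q + snd p), (snd q, snd p))"
  have "(f \<otimes>\<^bsub>mpoly_ring R n\<^esub> g \<otimes>\<^bsub>mpoly_ring R n\<^esub> h) \<alpha>
      = (\<Oplus>p\<in>splits \<alpha>. \<Oplus>q\<in>splits (fst p). f (fst q) \<otimes> g (snd q) \<otimes> h (snd p))"
    unfolding mpoly_ring_mult
    by (intro add.finprod_cong' refl finsum_ldistr) (auto simp: finite_splits cl intro!: finsum_closed)
  also have "\<dots> = (\<Oplus>x\<in>?L. f (fst (snd x)) \<otimes> g (snd (snd x)) \<otimes> h (snd (fst x)))"
    by (rule finsum_Sigma) (auto simp: finite_splits cl)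
  also have "\<dots> = (\<Oplus>x\<in>?L. f (fst (fst (?r x))) \<otimes> (g (fst (snd (?r x))) \<otimes> h (snd (snd (?r x)))))"
    by (intro add.finprod_cong' refl) (auto simp: cl m_assoc)
  also have "\<dots> = (\<Oplus>x\<in>?r ` ?L. f (fst (fst x)) \<otimes> (g (fst (snd x)) \<otimes> h (snd (snd x))))"
    by (rule finsum_reindex[symmetric]) (auto simp: cl inj_on_def splits_def)
  also have "?r ` ?L = ?R"
  proof
    show "?r ` ?L \<subseteq> ?R" by (auto simp: splits_def add.assoc)
    show "?R \<subseteq> ?r ` ?L"
    proof
      fix x assume "x \<in> ?R"
      then obtain \<beta> \<gamma> \<delta> where "x = ((\<beta>, \<gamma> + \<delta>), (\<gamma>, \<delta>))" "\<beta> + (\<gamma> + \<delta>) = \<alpha>"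
        by (auto simp: splits_def)
      then show "x \<in> ?r ` ?L"
        by (intro image_eqI[of _ _ "((\<beta> + \<gamma>, \<delta>), (\<beta>, \<gamma>))"]) (auto simp: splits_def add.assoc)
    qed
  qed
  also have "(\<Oplus>x\<in>?R. f (fst (fst x)) \<otimes> (g (fst (snd x)) \<otimes> h (snd (snd x))))
      = (\<Oplus>p\<in>splits \<alpha>. \<Oplus>q\<in>splits (snd p). f (fst p) \<otimes> (g (fst q) \<otimes> h (snd q)))"
    by (rule finsum_Sigma[symmetric]) (auto simp: finite_splits cl)
  also have "\<dots> = (f \<otimes>\<^bsub>mpoly_ring R n\<^esub> (g \<otimes>\<^bsub>mpoly_ring R n\<^esub> h)) \<alpha>"
    unfolding mpoly_ring_mult
    by (intro add.finprod_cong' refl finsum_rdistr[symmetric])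
      (auto simp: finite_splits cl intro!: finsum_closed)
  finally show "(f \<otimes>\<^bsub>mpoly_ring R n\<^esub> g \<otimes>\<^bsub>mpoly_ring R n\<^esub> h) \<alpha>
    = (f \<otimes>\<^bsub>mpoly_ring R n\<^esub> (g \<otimes>\<^bsub>mpoly_ring R n\<^esub> h)) \<alpha>" .
qed

lemma mpoly_mult_comm:
  assumes f: "f \<in> carrier (mpoly_ring R n)" and g: "g \<in> carrier (mpoly_ring R n)"
  shows "f \<otimes>\<^bsub>mpoly_ring R n\<^esub> g = g \<otimes>\<^bsub>mpoly_ring R n\<^esub> f"
proof
  fix \<alpha>
  note cl = mpoly_coeff_closed[OF f] mpoly_coeff_closed[OF g]
  have swap: "prod.swap ` splits \<alpha> = splits \<alpha>"
    by (force simp: splits_def add.commute)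
  have "(\<Oplus>p\<in>prod.swap ` splits \<alpha>. f (fst p) \<otimes> g (snd p)) = (\<Oplus>p\<in>splits \<alpha>. f (snd p) \<otimes> g (fst p))"
    by (subst finsum_reindex) (auto simp: cl)
  also have "\<dots> = (\<Oplus>p\<in>splits \<alpha>. g (fst p) \<otimes> f (snd p))"
    by (intro add.finprod_cong' refl) (auto simp: cl m_comm)
  finally show "(f \<otimes>\<^bsub>mpoly_ring R n\<^esub> g) \<alpha> = (g \<otimes>\<^bsub>mpoly_ring R n\<^esub> f) \<alpha>"
    by (simp add: mpoly_ring_mult swap)
qed

lemma mpoly_l_one:
  assumes f: "f \<in> carrier (mpoly_ring R n)"
  shows "\<one>\<^bsub>mpoly_ring R n\<^esub> \<otimes>\<^bsub>mpoly_ring R n\<^esub> f = f"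
proof
  fix \<alpha>
  note cl = mpoly_coeff_closed[OF f]
  have "(\<Oplus>p\<in>splits \<alpha>. (if fst p = 0 then \<one> else \<zero>) \<otimes> f (snd p)) = f \<alpha>"
    by (subst finsum_mono_neutral_right[where A = "{(0, \<alpha>)}"])
      (auto simp: cl finite_splits, auto simp: splits_def)
  then show "(\<one>\<^bsub>mpoly_ring R n\<^esub> \<otimes>\<^bsub>mpoly_ring R n\<^esub> f) \<alpha> = f \<alpha>"
    by (simp add: mpoly_ring_mult mpoly_ring_one cl)
qed

text \<open>Needed to treat \<open>spec_ideal\<close>, defined through \<open>genideal\<close>, as
  the least ideal containing the specialized polynomials.\<close>

lemma mpoly_ring_is_cring: "cring (mpoly_ring R n)"
proof (rule cringI)
  show "abelian_group (mpoly_ring R n)"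
  proof (rule abelian_groupI)
    fix f assume f: "f \<in> carrier (mpoly_ring R n)"
    have "(\<ominus> f \<alpha> \<noteq> \<zero>) = (f \<alpha> \<noteq> \<zero>)" for \<alpha>
      using mpoly_coeff_closed[OF f, of \<alpha>] by (metis minus_minus minus_zero)
    then have "(\<lambda>\<alpha>. \<ominus> f \<alpha>) \<in> carrier (mpoly_ring R n)"
      using f by (simp add: mpoly_ring_carrier)
    moreover have "(\<lambda>\<alpha>. \<ominus> f \<alpha>) \<oplus>\<^bsub>mpoly_ring R n\<^esub> f = \<zero>\<^bsub>mpoly_ring R n\<^esub>"
      using mpoly_coeff_closed[OF f] by (auto simp: mpoly_ring_add mpoly_ring_zero l_neg)
    ultimately show "\<exists>g\<in>carrier (mpoly_ring R n). g \<oplus>\<^bsub>mpoly_ring R n\<^esub> f = \<zero>\<^bsub>mpoly_ring R n\<^esub>" by blast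
  next
    fix f g h
    assume "f \<in> carrier (mpoly_ring R n)" "g \<in> carrier (mpoly_ring R n)" "h \<in> carrier (mpoly_ring R n)"
    then show "f \<oplus>\<^bsub>mpoly_ring R n\<^esub> g \<oplus>\<^bsub>mpoly_ring R n\<^esub> h = f \<oplus>\<^bsub>mpoly_ring R n\<^esub> (g \<oplus>\<^bsub>mpoly_ring R n\<^esub> h)"
      by (simp add: mpoly_ring_add mpoly_coeff_closed a_assoc)
  next
    fix f g
    assume "f \<in> carrier (mpoly_ring R n)" "g \<in> carrier (mpoly_ring R n)"
    then show "f \<oplus>\<^bsub>mpoly_ring R n\<^esub> g = g \<oplus>\<^bsub>mpoly_ring R n\<^esub> f" "f \<oplus>\<^bsub>mpoly_ring R n\<^esub> g \<in> carrier (mpoly_ring R n)"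
      by (simp_all add: mpoly_add_closed) (simp add: mpoly_ring_add mpoly_coeff_closed a_comm)
  next
    fix f
    assume "f \<in> carrier (mpoly_ring R n)"
    then show "\<zero>\<^bsub>mpoly_ring R n\<^esub> \<oplus>\<^bsub>mpoly_ring R n\<^esub> f = f"
      by (simp add: mpoly_ring_add mpoly_ring_zero mpoly_coeff_closed)
  next
    show "\<zero>\<^bsub>mpoly_ring R n\<^esub> \<in> carrier (mpoly_ring R n)"
      by (simp add: mpoly_ring_carrier mpoly_ring_zero)
  qed
  show "comm_monoid (mpoly_ring R n)"
  proof (rule comm_monoidI)
    show "\<one>\<^bsub>mpoly_ring R n\<^esub> \<in> carrier (mpoly_ring R n)"
      by (auto simp: mpoly_ring_carrier mpoly_ring_one)
  qed (fact mpoly_mult_closed mpoly_mult_assoc mpoly_l_one mpoly_mult_comm)+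
  fix f g h
  assume f: "f \<in> carrier (mpoly_ring R n)" and g: "g \<in> carrier (mpoly_ring R n)"
    and h: "h \<in> carrier (mpoly_ring R n)"
  note cl = mpoly_coeff_closed[OF f] mpoly_coeff_closed[OF g] mpoly_coeff_closed[OF h]
  show "(f \<oplus>\<^bsub>mpoly_ring R n\<^esub> g) \<otimes>\<^bsub>mpoly_ring R n\<^esub> h =
      f \<otimes>\<^bsub>mpoly_ring R n\<^esub> h \<oplus>\<^bsub>mpoly_ring R n\<^esub> g \<otimes>\<^bsub>mpoly_ring R n\<^esub> h"
    by (rule ext) (simp add: mpoly_ring_mult mpoly_ring_add l_distr cl)
qed

end

section \<open>Two variables in degrees one and two\<close>

text \<open>Keeps the variable index 1 from being rewritten to \<open>Suc 0\<close>.\<close>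

declare One_nat_def [simp del]

section \<open>Monomials in two variables\<close>

definition xvar :: "nat \<Rightarrow> exponent" where
  "xvar i = Poly_Mapping.single i 1"

lemma lookup_xvar: "Poly_Mapping.lookup (xvar i) j = (if i = j then 1 else 0)"
  by (simp add: xvar_def lookup_single when_def)

lemma keys_xvar [simp]: "Poly_Mapping.keys (xvar i) = {i}"
  by (simp add: xvar_def)

lemma xvar_add_self: "xvar i + xvar i = Poly_Mapping.single i 2"
  by (simp add: xvar_def numeral_2_eq_2 flip: single_add)

lemma exponent_two_variables:
  assumes "Poly_Mapping.keys \<alpha> \<subseteq> {..<2::nat}"
  shows "\<alpha> = Poly_Mapping.single 0 (Poly_Mapping.lookup \<alpha> 0) + Poly_Mapping.single 1 (Poly_Mapping.lookup \<alpha> 1)"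
proof (rule poly_mapping_eqI)
  fix k
  show "Poly_Mapping.lookup \<alpha> k = Poly_Mapping.lookup
    (Poly_Mapping.single 0 (Poly_Mapping.lookup \<alpha> 0) + Poly_Mapping.single 1 (Poly_Mapping.lookup \<alpha> 1)) k"
  proof (cases "k < 2")
    case True
    then have "k = 0 \<or> k = 1" by auto
    then show ?thesis by (auto simp: lookup_add lookup_single)
  next
    case False
    then have "k \<notin> Poly_Mapping.keys \<alpha>" using assms by auto
    then show ?thesis using False by (auto simp: lookup_add lookup_single in_keys_iff when_def)
  qed
qed

lemma mdeg_two_variables:
  assumes "Poly_Mapping.keys \<alpha> \<subseteq> {..<2::nat}"
  shows "mdeg \<alpha> = Poly_Mapping.lookup \<alpha> 0 + Poly_Mapping.lookup \<alpha> 1"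
proof -
  have "mdeg \<alpha> = (\<Sum>j<2. Poly_Mapping.lookup \<alpha> j)"
    unfolding mdeg_def by (rule sum.mono_neutral_left) (use assms in \<open>auto simp: in_keys_iff\<close>)
  then show ?thesis by (simp add: numeral_2_eq_2 One_nat_def)
qed

lemma mdeg_single [simp]: "mdeg (Poly_Mapping.single i k) = k"
  by (simp add: mdeg_def)

lemma mdeg_xvar [simp]: "mdeg (xvar i) = 1"
  by (simp only: xvar_def mdeg_single)

lemma monomials_1: "monomials 2 1 = {xvar 0, xvar 1}"
proof
  show "monomials 2 1 \<subseteq> {xvar 0, xvar 1}"
  proof
    fix \<alpha> assume "\<alpha> \<in> monomials 2 1"
    then have k: "Poly_Mapping.keys \<alpha> \<subseteq> {..<2}" and "mdeg \<alpha> = 1" by (auto simp: monomials_def)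
    then have "Poly_Mapping.lookup \<alpha> 0 = 0 \<and> Poly_Mapping.lookup \<alpha> 1 = 1 \<or>
        Poly_Mapping.lookup \<alpha> 0 = 1 \<and> Poly_Mapping.lookup \<alpha> 1 = 0"
      using mdeg_two_variables[OF k] by auto
    then show "\<alpha> \<in> {xvar 0, xvar 1}"
      using exponent_two_variables[OF k] by (auto simp: xvar_def)
  qed
qed (auto simp: monomials_def)

text \<open>The quadratic monomials are kept as sums of two \<open>xvar\<close>s, the shape in which
  they arise from products of linear forms.\<close>

lemma monomials_2: "monomials 2 2 = {xvar 0 + xvar 0, xvar 0 + xvar 1, xvar 1 + xvar 1}"
proof
  show "monomials 2 2 \<subseteq> {xvar 0 + xvar 0, xvar 0 + xvar 1, xvar 1 + xvar 1}"
  proof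
    fix \<alpha> assume "\<alpha> \<in> monomials 2 2"
    then have k: "Poly_Mapping.keys \<alpha> \<subseteq> {..<2}" and "mdeg \<alpha> = 2" by (auto simp: monomials_def)
    then have "Poly_Mapping.lookup \<alpha> 0 + Poly_Mapping.lookup \<alpha> 1 = 2"
      using mdeg_two_variables[OF k] by simp
    then consider "Poly_Mapping.lookup \<alpha> 0 = 0" "Poly_Mapping.lookup \<alpha> 1 = 2"
      | "Poly_Mapping.lookup \<alpha> 0 = 1" "Poly_Mapping.lookup \<alpha> 1 = 1"
      | "Poly_Mapping.lookup \<alpha> 0 = 2" "Poly_Mapping.lookup \<alpha> 1 = 0"
      by linarith
    then show "\<alpha> \<in> {xvar 0 + xvar 0, xvar 0 + xvar 1, xvar 1 + xvar 1}"
      using exponent_two_variables[OF k] by cases (simp_all add: xvar_add_self, simp_all add: xvar_def)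
  qed
  have "xvar i + xvar j \<in> monomials 2 2" if "i < 2" "j < 2" for i j
  proof -
    have k: "Poly_Mapping.keys (xvar i + xvar j) \<subseteq> {..<2}"
      using keys_add[of "xvar i" "xvar j"] that by auto
    have "i = 0 \<or> i = 1" "j = 0 \<or> j = 1" using that by auto
    then have "mdeg (xvar i + xvar j) = 2"
      unfolding mdeg_two_variables[OF k] by (auto simp: lookup_add lookup_xvar)
    then show ?thesis using k by (simp add: monomials_def)
  qed
  from this[of 0 0] this[of 0 1] this[of 1 1]
  show "{xvar 0 + xvar 0, xvar 0 + xvar 1, xvar 1 + xvar 1} \<subseteq> monomials 2 2"
    by simp
qed

text \<open>The exponent of \<open>x_0\<close> tells them apart: it is 1 and 0 on the variables, and
  2, 1, 0 on the quadratic monomials.\<close>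

lemma xvar_sums_distinct:
  "xvar 0 \<noteq> xvar 1" "xvar 0 + xvar 0 \<noteq> xvar 0 + xvar 1" "xvar 0 + xvar 0 \<noteq> xvar 1 + xvar 1" "xvar 0 + xvar 1 \<noteq> xvar 1 + xvar 1"
  by (auto simp: poly_mapping_eq_iff fun_eq_iff lookup_add lookup_xvar
      intro!: exI[of _ "0::nat"])

text \<open>Stated for every \<open>t\<close> so that it also covers the cubic \<open>P_1\<close>,
  whose monomials are never listed.\<close>

lemma finite_monomials_2: "finite (monomials 2 t)"
proof (rule finite_subset)
  let ?m = "\<lambda>(i, j). Poly_Mapping.single (0::nat) i + Poly_Mapping.single 1 (j::nat)"
  show "monomials 2 t \<subseteq> ?m ` ({..t} \<times> {..t})"
  proof
    fix \<alpha> assume "\<alpha> \<in> monomials 2 t"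
    then have k: "Poly_Mapping.keys \<alpha> \<subseteq> {..<2}" and "mdeg \<alpha> = t" by (auto simp: monomials_def)
    then have "Poly_Mapping.lookup \<alpha> 0 + Poly_Mapping.lookup \<alpha> 1 = t"
      using mdeg_two_variables[OF k] by simp
    then show "\<alpha> \<in> ?m ` ({..t} \<times> {..t})"
      using exponent_two_variables[OF k]
      by (intro image_eqI[of _ _ "(Poly_Mapping.lookup \<alpha> 0, Poly_Mapping.lookup \<alpha> 1)"]) auto
  qed
qed simp

text \<open>Here \<rho> = 0 + 2 = 2 and the least degree is 1, so the boundary degree is \<nu> = 2 -
  1 + 1 = 2.\<close>

definition degs :: "nat \<Rightarrow> nat" where
  "degs i = (if i = 0 then 1 else 3)"

text \<open>Exponents are natural numbers, so wherever the sum of two of them vanishes, both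
  vanish.\<close>

lemma splits_single:
  assumes "(\<beta>, \<gamma>) \<in> splits (Poly_Mapping.single i k)"
  obtains l where "l \<le> k" "\<beta> = Poly_Mapping.single i l"
proof
  have eq: "Poly_Mapping.lookup \<beta> j + Poly_Mapping.lookup \<gamma> j = (k when i = j)" for j
    using assms by (auto simp: splits_def lookup_add[symmetric] lookup_single)
  show "Poly_Mapping.lookup \<beta> i \<le> k" using eq[of i] by simp
  show "\<beta> = Poly_Mapping.single i (Poly_Mapping.lookup \<beta> i)"
  proof (rule poly_mapping_eqI)
    fix j
    show "Poly_Mapping.lookup \<beta> j = Poly_Mapping.lookup (Poly_Mapping.single i (Poly_Mapping.lookup \<beta> i)) j"
      using eq[of j] by (cases "i = j") (auto simp: lookup_single)
  qed
qed

section \<open>An ideal of polynomials and products of linear forms\<close>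

context coeff_cring
begin

lemma lin_comb_in_mpoly_ring:
  assumes "finite M" "\<And>\<alpha>. \<alpha> \<in> M \<Longrightarrow> Poly_Mapping.keys \<alpha> \<subseteq> {..<n}" "\<And>\<alpha>. \<alpha> \<in> M \<Longrightarrow> c \<alpha> \<in> carrier R"
  shows "lin_comb R M c \<in> carrier (mpoly_ring R n)"
  using assms by (auto simp: mpoly_ring_carrier lin_comb_def elim: finite_subset[rotated])

text \<open>For \<open>i < n\<close> this is the preimage of the ideal generated by
  \<open>x_i^(k+1)\<close> under setting all other variables to zero. It absorbs products because a
  pure power splits only into pure powers of the same variable, with first factor of exponent at
  most \<open>k\<close>.\<close>

lemma vanishing_on_low_powers_ideal:
  "ideal {f \<in> carrier (mpoly_ring R n). \<forall>l\<le>k. f (Poly_Mapping.single i l) = \<zero>} (mpoly_ring R n)"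
    (is "ideal ?J _")
proof -
  interpret M: cring "mpoly_ring R n" by (rule mpoly_ring_is_cring)
  have mult: "f \<otimes>\<^bsub>mpoly_ring R n\<^esub> g \<in> ?J"
    if f: "f \<in> ?J" and g: "g \<in> carrier (mpoly_ring R n)" for f g
  proof -
    have "(f \<otimes>\<^bsub>mpoly_ring R n\<^esub> g) (Poly_Mapping.single i l) = \<zero>" if "l \<le> k" for l
    proof -
      have "f \<beta> \<otimes> g \<gamma> = \<zero>" if "(\<beta>, \<gamma>) \<in> splits (Poly_Mapping.single i l)" for \<beta> \<gamma>
        using that \<open>l \<le> k\<close> f mpoly_coeff_closed[OF g] by (elim splits_single) auto
      then show ?thesis
        unfolding mpoly_ring_mult by (intro add.finprod_one_eqI) auto
    qed
    then show ?thesis using f g by (simp add: mpoly_mult_closed)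
  qed
  show ?thesis
  proof (rule idealI)
    show "subgroup ?J (add_monoid (mpoly_ring R n))"
    proof (rule M.add.subgroupI)
      show "?J \<noteq> {}"
        using M.zero_closed by (auto simp: mpoly_ring_zero)
    next
      fix f assume f: "f \<in> ?J"
      \<comment> \<open>Writing the negative as a multiple by -1 reduces closure under negation to
        absorption of products.\<close>
      then have "\<ominus>\<^bsub>mpoly_ring R n\<^esub> f = f \<otimes>\<^bsub>mpoly_ring R n\<^esub> (\<ominus>\<^bsub>mpoly_ring R n\<^esub> \<one>\<^bsub>mpoly_ring R n\<^esub>)"
        by (simp add: M.r_minus)
      then show "\<ominus>\<^bsub>mpoly_ring R n\<^esub> f \<in> ?J"
        using mult[OF f] by simp
    next
      fix f g assume "f \<in> ?J" "g \<in> ?J"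
      then show "f \<oplus>\<^bsub>mpoly_ring R n\<^esub> g \<in> ?J"
        using M.a_closed[of f g] by (simp add: mpoly_ring_add)
    qed auto
  next
    fix f g assume fg: "f \<in> ?J" "g \<in> carrier (mpoly_ring R n)"
    show "f \<otimes>\<^bsub>mpoly_ring R n\<^esub> g \<in> ?J" using mult[OF fg] .
    then show "g \<otimes>\<^bsub>mpoly_ring R n\<^esub> f \<in> ?J"
      using fg mpoly_mult_comm[of f n g] by simp
  qed (rule M.ring_axioms)
qed

text \<open>Only splits into two variables contribute, since both factors are supported on
  variables. Each square has one such split, while the mixed monomial has two ordered ones.\<close>

lemma mult_linear_forms:
  assumes p: "p = lin_comb R {xvar 0, xvar 1} c" "c (xvar 0) \<in> carrier R" "c (xvar 1) \<in> carrier R"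
    and q: "q = lin_comb R {xvar 0, xvar 1} c'" "c' (xvar 0) \<in> carrier R" "c' (xvar 1) \<in> carrier R"
  shows "(p \<otimes>\<^bsub>mpoly_ring R 2\<^esub> q) (xvar 0 + xvar 0) = c (xvar 0) \<otimes> c' (xvar 0)"
    and "(p \<otimes>\<^bsub>mpoly_ring R 2\<^esub> q) (xvar 0 + xvar 1) = c (xvar 0) \<otimes> c' (xvar 1) \<oplus> c (xvar 1) \<otimes> c' (xvar 0)"
    and "(p \<otimes>\<^bsub>mpoly_ring R 2\<^esub> q) (xvar 1 + xvar 1) = c (xvar 1) \<otimes> c' (xvar 1)"
    and "\<alpha> \<notin> {xvar 0 + xvar 0, xvar 0 + xvar 1, xvar 1 + xvar 1} \<Longrightarrow> (p \<otimes>\<^bsub>mpoly_ring R 2\<^esub> q) \<alpha> = \<zero>"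
proof -
  let ?V = "{xvar 0, xvar 1} \<times> {xvar 0, xvar 1}"
  have pq: "p \<beta> \<in> carrier R" "q \<beta> \<in> carrier R" for \<beta>
    using p q by (auto simp: lin_comb_def)
  have eq: "(p \<otimes>\<^bsub>mpoly_ring R 2\<^esub> q) \<alpha> = (\<Oplus>x\<in>splits \<alpha> \<inter> ?V. p (fst x) \<otimes> q (snd x))" for \<alpha>
    unfolding mpoly_ring_mult
    by (rule finsum_mono_neutral_right)
      (use pq p q in \<open>auto simp: finite_splits lin_comb_def\<close>)
  have comm: "xvar 1 + xvar 0 = xvar 0 + xvar 1" by (rule add.commute)
  note d = xvar_sums_distinct xvar_sums_distinct[symmetric]
  have s: "splits (xvar 0 + xvar 0) \<inter> ?V = {(xvar 0, xvar 0)}"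
    "splits (xvar 0 + xvar 1) \<inter> ?V = {(xvar 0, xvar 1), (xvar 1, xvar 0)}"
    "splits (xvar 1 + xvar 1) \<inter> ?V = {(xvar 1, xvar 1)}"
    unfolding splits_def using d comm by auto
  have v: "p (xvar 0) = c (xvar 0)" "p (xvar 1) = c (xvar 1)" "q (xvar 0) = c' (xvar 0)" "q (xvar 1) = c' (xvar 1)"
    by (auto simp: p(1) q(1) lin_comb_def)
  show "(p \<otimes>\<^bsub>mpoly_ring R 2\<^esub> q) (xvar 0 + xvar 0) = c (xvar 0) \<otimes> c' (xvar 0)"
    "(p \<otimes>\<^bsub>mpoly_ring R 2\<^esub> q) (xvar 0 + xvar 1) = c (xvar 0) \<otimes> c' (xvar 1) \<oplus> c (xvar 1) \<otimes> c' (xvar 0)"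
    "(p \<otimes>\<^bsub>mpoly_ring R 2\<^esub> q) (xvar 1 + xvar 1) = c (xvar 1) \<otimes> c' (xvar 1)"
    unfolding eq s using p(2,3) q(2,3) d(1) by (simp_all add: v)
  assume "\<alpha> \<notin> {xvar 0 + xvar 0, xvar 0 + xvar 1, xvar 1 + xvar 1}"
  then have "splits \<alpha> \<inter> ?V = {}" by (auto simp: splits_def comm)
  then show "(p \<otimes>\<^bsub>mpoly_ring R 2\<^esub> q) \<alpha> = \<zero>" unfolding eq by simp
qed

end

section \<open>The universal property\<close>

lemma coeff_var_in_coeff_ring:
  assumes "i < n" "\<alpha> \<in> monomials n (d i)"
  shows "coeff_var i \<alpha> \<in> carrier (coeff_ring n d)"
  using assms by (simp add: coeff_var_def coeff_ring_def coeff_indices_def)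

text \<open>The complement condition is governed by the coefficient \<open>b\<close> of
  \<open>x_1\<close> in \<open>P_0\<close>. If \<open>b\<close> vanishes, an ideal avoiding
  \<open>x_1^2\<close> contains all generators; otherwise a triangular system with diagonal entries
  \<open>b\<close> is solved. The result serves both for the existence of a subresultant and for
  constraining an arbitrary one.\<close>

lemma spec_ideal_complement_iff:
  fixes K :: "'k ring"
  assumes K: "field K" and \<phi>: "\<phi> \<in> ring_hom (coeff_ring 2 degs) K"
  shows "\<phi> (coeff_var 0 (xvar 1)) \<noteq> \<zero>\<^bsub>K\<^esub> \<longleftrightarrow>
    set_add (mpoly_ring K 2) (spec_ideal K 2 degs \<phi> \<inter> degree_part K 2 2)
        (monomial_span K {xvar 0 + xvar 0}) = degree_part K 2 2"
    (is "_ \<longleftrightarrow> ?sum = _")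
proof -
  interpret field K by fact
  interpret coeff_cring K by unfold_locales
  interpret M: cring "mpoly_ring K 2" by (rule mpoly_ring_is_cring)
  let ?R = "mpoly_ring K 2" and ?P = "spec_poly K 2 degs \<phi>" and ?D = "degree_part K 2 2"
  let ?I = "spec_ideal K 2 degs \<phi>" and ?N = "monomial_span K {xvar 0 + xvar 0}"
  define a b where "a = \<phi> (coeff_var 0 (xvar 0))" and "b = \<phi> (coeff_var 0 (xvar 1))"
  have \<phi>_closed: "\<phi> (coeff_var i \<alpha>) \<in> carrier K" if "i < 2" "\<alpha> \<in> monomials 2 (degs i)" for i \<alpha>
    using ring_hom_closed[OF \<phi>] coeff_var_in_coeff_ring[of i 2 \<alpha> degs] that by simp
  have deg_1: "monomials 2 (degs 0) = {xvar 0, xvar 1}"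
    using monomials_1 by (simp add: degs_def)
  have ab: "a \<in> carrier K" "b \<in> carrier K"
    using \<phi>_closed[of 0] deg_1 by (auto simp: a_def b_def)
  have P_closed: "?P i \<in> carrier ?R" if "i < 2" for i
    unfolding spec_poly_def using finite_monomials_2 \<phi>_closed[OF that]
    by (intro lin_comb_in_mpoly_ring) (auto simp: monomials_def)
  have P_0: "?P 0 = lin_comb K {xvar 0, xvar 1} (\<lambda>\<alpha>. \<phi> (coeff_var 0 \<alpha>))"
    unfolding spec_poly_def deg_1 ..
  interpret I: ideal ?I ?R
    unfolding spec_ideal_def using P_closed by (intro M.genideal_ideal) auto
  have D_nonzero: "\<alpha> \<in> {xvar 0 + xvar 0, xvar 0 + xvar 1, xvar 1 + xvar 1}"
    if "f \<in> ?D" "f \<alpha> \<noteq> \<zero>\<^bsub>K\<^esub>" for f \<alpha>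
    using that unfolding monomials_2[symmetric]
    by (auto simp: degree_part_def monomials_def mpoly_ring_carrier)
  have D_lin_comb: "lin_comb K M c \<in> ?D"
    if "M \<subseteq> {xvar 0 + xvar 0, xvar 0 + xvar 1, xvar 1 + xvar 1}" "c \<in> M \<rightarrow> carrier K" for M c
  proof -
    have M: "M \<subseteq> monomials 2 2" using that(1) unfolding monomials_2 .
    then have "lin_comb K M c \<in> carrier ?R"
      using that(2) finite_subset[OF M finite_monomials_2]
      by (intro lin_comb_in_mpoly_ring) (auto simp: monomials_def)
    then show ?thesis using M by (auto simp: degree_part_def lin_comb_def monomials_def)
  qed
  have N_sub: "?N \<subseteq> ?D"
    using D_lin_comb[of "{xvar 0 + xvar 0}"] by (auto simp: monomial_span_def)
  have D_add: "f \<oplus>\<^bsub>?R\<^esub> g \<in> ?D" if "f \<in> ?D" "g \<in> ?D" for f g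
  proof -
    have "f \<alpha> \<noteq> \<zero>\<^bsub>K\<^esub> \<or> g \<alpha> \<noteq> \<zero>\<^bsub>K\<^esub>" if "f \<alpha> \<oplus>\<^bsub>K\<^esub> g \<alpha> \<noteq> \<zero>\<^bsub>K\<^esub>" for \<alpha>
      using that by auto
    then show ?thesis
      using that M.a_closed[of f g] by (auto simp: degree_part_def mpoly_ring_add)
  qed
  have sum_sub: "?sum \<subseteq> ?D"
    using D_add N_sub by (auto simp: set_add_def')
  have neq: "xvar 0 + xvar 0 \<noteq> xvar 1 + xvar 1"
    by (rule xvar_sums_distinct)
  have "b \<noteq> \<zero>\<^bsub>K\<^esub>" if eq: "?sum = ?D"
  proof
    assume b0: "b = \<zero>\<^bsub>K\<^esub>"
    \<comment> \<open>For \<open>b\<close> = 0 the form \<open>P_0\<close> is a multiple of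
      \<open>x_0\<close> and so lies in this ideal. The bound 2 is \<nu>, which keeps
      \<open>x_1^2\<close> out.\<close>
    let ?J = "{f \<in> carrier ?R. \<forall>l\<le>2. f (Poly_Mapping.single 1 l) = \<zero>\<^bsub>K\<^esub>}"
    have "?P 0 \<in> ?J"
    proof -
      have "?P 0 (Poly_Mapping.single 1 l) = \<zero>\<^bsub>K\<^esub>" for l
      proof -
        have "Poly_Mapping.lookup (Poly_Mapping.single 1 l) (0::nat) \<noteq> Poly_Mapping.lookup (xvar 0) 0"
          by (simp add: lookup_single lookup_xvar when_def)
        then have "Poly_Mapping.single 1 l \<noteq> xvar 0" by auto
        then show ?thesis
          using b0 unfolding P_0 lin_comb_def b_def by simp
      qed
      then show ?thesis using P_closed[of 0] by simp
    qed
    \<comment> \<open>All monomials of \<open>P_1\<close> have degree 3, above the powers tested by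
      \<open>?J\<close>.\<close>
    moreover have "?P 1 \<in> ?J"
      using P_closed[of 1] by (auto simp: spec_poly_def lin_comb_def monomials_def degs_def)
    ultimately have "?P ` {..<2} \<subseteq> ?J"
      by (auto simp: less_2_cases_iff One_nat_def)
    then have I_sub: "?I \<subseteq> ?J"
      unfolding spec_ideal_def by (rule M.genideal_minimal[OF vanishing_on_low_powers_ideal])
    \<comment> \<open>The monomial \<open>x_1^2\<close> is the obstruction: elements of
      \<open>?J\<close> and of the span of \<open>x_0^2\<close> both have coefficient zero
      there.\<close>
    have "lin_comb K {xvar 1 + xvar 1} (\<lambda>_. \<one>\<^bsub>K\<^esub>) \<in> ?sum"
      unfolding eq by (rule D_lin_comb) auto
    then obtain f g where fg: "lin_comb K {xvar 1 + xvar 1} (\<lambda>_. \<one>\<^bsub>K\<^esub>) = f \<oplus>\<^bsub>?R\<^esub> g" "f \<in> ?I" "g \<in> ?N"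
      by (auto simp: set_add_def')
    have "f (xvar 1 + xvar 1) = \<zero>\<^bsub>K\<^esub>"
      using fg(2) I_sub by (auto simp: xvar_add_self)
    moreover have "g (xvar 1 + xvar 1) = \<zero>\<^bsub>K\<^esub>"
      using fg(3) neq by (auto simp: monomial_span_def lin_comb_def)
    ultimately show False
      using fun_cong[OF fg(1), of "xvar 1 + xvar 1"]
      by (simp add: lin_comb_def mpoly_ring_add)
  qed
  moreover have "?sum = ?D" if b: "b \<noteq> \<zero>\<^bsub>K\<^esub>"
  proof
    show "?D \<subseteq> ?sum"
    proof
      fix f assume f: "f \<in> ?D"
      have cl: "f \<alpha> \<in> carrier K" for \<alpha>
        using f mpoly_coeff_closed[of f 2] by (simp add: degree_part_def)
      \<comment> \<open>Back substitution: in \<open>(v x_0 + u x_1) (a x_0 + b x_1)\<close> the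
        coefficient of \<open>x_1^2\<close> is \<open>u b\<close> and that of \<open>x_0 x_1\<close>
        is \<open>v b + u a\<close>. These are matched with \<open>f\<close> in this order.\<close>
      define u v where "u = f (xvar 1 + xvar 1) \<otimes>\<^bsub>K\<^esub> inv\<^bsub>K\<^esub> b"
        and "v = (f (xvar 0 + xvar 1) \<ominus>\<^bsub>K\<^esub> u \<otimes>\<^bsub>K\<^esub> a) \<otimes>\<^bsub>K\<^esub> inv\<^bsub>K\<^esub> b"
      have ib: "inv\<^bsub>K\<^esub> b \<in> carrier K" "inv\<^bsub>K\<^esub> b \<otimes>\<^bsub>K\<^esub> b = \<one>\<^bsub>K\<^esub>"
        using b ab by (auto simp: field_Units)
      have uv: "u \<in> carrier K" "v \<in> carrier K"
        using cl ab ib by (auto simp: u_def v_def)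
      have ub: "u \<otimes>\<^bsub>K\<^esub> b = f (xvar 1 + xvar 1)"
        using cl ab ib by (simp add: u_def m_assoc)
      have vb: "v \<otimes>\<^bsub>K\<^esub> b \<oplus>\<^bsub>K\<^esub> u \<otimes>\<^bsub>K\<^esub> a = f (xvar 0 + xvar 1)"
        using cl[of "xvar 0 + xvar 1"] ab ib uv by (simp add: v_def m_assoc minus_eq a_assoc l_neg)
      define q where "q = lin_comb K {xvar 0, xvar 1} (\<lambda>\<alpha>. if \<alpha> = xvar 0 then v else u)"
      have "q \<in> carrier ?R"
        unfolding q_def using uv by (intro lin_comb_in_mpoly_ring) auto
      define g where "g = q \<otimes>\<^bsub>?R\<^esub> ?P 0"
      \<comment> \<open>What remains is the discrepancy at \<open>x_0^2\<close>, which the span of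
        \<open>S\<close> absorbs.\<close>
      define h where "h = lin_comb K {xvar 0 + xvar 0} (\<lambda>\<alpha>. f \<alpha> \<ominus>\<^bsub>K\<^esub> v \<otimes>\<^bsub>K\<^esub> a)"
      have "h \<in> ?N"
        using cl uv ab unfolding h_def monomial_span_def by blast
      have g_vals: "g (xvar 0 + xvar 0) = v \<otimes>\<^bsub>K\<^esub> a"
        "g (xvar 0 + xvar 1) = v \<otimes>\<^bsub>K\<^esub> b \<oplus>\<^bsub>K\<^esub> u \<otimes>\<^bsub>K\<^esub> a"
        "g (xvar 1 + xvar 1) = u \<otimes>\<^bsub>K\<^esub> b"
        "\<alpha> \<notin> {xvar 0 + xvar 0, xvar 0 + xvar 1, xvar 1 + xvar 1} \<Longrightarrow> g \<alpha> = \<zero>\<^bsub>K\<^esub>" for \<alpha>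
        using mult_linear_forms[OF q_def _ _ P_0] uv ab xvar_sums_distinct(1)
        by (simp_all add: g_def a_def b_def)
      have "f \<alpha> = (g \<oplus>\<^bsub>?R\<^esub> h) \<alpha>" for \<alpha>
      proof -
        consider "\<alpha> = xvar 0 + xvar 0" | "\<alpha> = xvar 0 + xvar 1" | "\<alpha> = xvar 1 + xvar 1"
          | "\<alpha> \<notin> {xvar 0 + xvar 0, xvar 0 + xvar 1, xvar 1 + xvar 1}" by auto
        then show ?thesis
        proof cases
          case 1
          have "c = d \<oplus>\<^bsub>K\<^esub> (c \<ominus>\<^bsub>K\<^esub> d)" if "c \<in> carrier K" "d \<in> carrier K" for c d
            using that by algebra
          then show ?thesis
            unfolding 1 mpoly_ring_add g_vals using cl ab uv by (simp add: h_def lin_comb_def)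
        next
          case 2
          then show ?thesis
            using xvar_sums_distinct unfolding 2 mpoly_ring_add g_vals vb
            by (simp add: h_def lin_comb_def cl)
        next
          case 3
          then show ?thesis
            using xvar_sums_distinct unfolding 3 mpoly_ring_add g_vals ub
            by (simp add: h_def lin_comb_def cl)
        next
          case 4
          then have "f \<alpha> = \<zero>\<^bsub>K\<^esub>" using D_nonzero[OF f] by blast
          then show ?thesis
            using 4 unfolding mpoly_ring_add g_vals(4)[OF 4] by (simp add: h_def lin_comb_def)
        qed
      qed
      then have fgh: "f = g \<oplus>\<^bsub>?R\<^esub> h" by blast
      have "?P 0 \<in> ?I"
        unfolding spec_ideal_def using P_closed by (intro M.genideal_self[THEN subsetD]) auto
      then have gI: "g \<in> ?I"
        unfolding g_def using \<open>q \<in> carrier ?R\<close> by (rule I.I_l_closed)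
      have "g \<in> ?D"
      proof -
        have "mdeg \<alpha> = 2" if "g \<alpha> \<noteq> \<zero>\<^bsub>K\<^esub>" for \<alpha>
          using that g_vals(4) monomials_2 by (auto simp: monomials_def)
        then show ?thesis using I.a_subset gI by (auto simp: degree_part_def)
      qed
      then show "f \<in> ?sum"
        using fgh gI \<open>h \<in> ?N\<close> by (auto simp: set_add_def')
    qed
  qed (rule sum_sub)
  ultimately show ?thesis by (auto simp: b_def)
qed

text \<open>The first value is the required cardinality of \<open>S\<close>. The second, taken at
  \<nu> - 1, is the degree of a subresultant in the coefficients of \<open>P_0\<close>. For
  \<open>P_1\<close> the argument \<nu> - 3 is negative.\<close>

lemma ci_hilbert_degs:
  "ci_hilbert 2 degs {..<2} 2 = 1"
  "ci_hilbert 2 degs ({..<2} - {0}) 1 = 2"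
proof -
  let ?X = "fps_X :: rat fps"
  \<comment> \<open>This factorization cancels the whole denominator
    \<open>(1 - X)^2\<close>.\<close>
  have cube: "(1 - ?X) * (1 + ?X + ?X ^ 2) = 1 - ?X ^ 3"
    by (simp add: algebra_simps power3_eq_cube power2_eq_square)
  have nz: "1 - ?X \<noteq> 0"
  proof
    assume "1 - ?X = 0"
    then have "fps_nth (1 - ?X) 0 = fps_nth 0 0" by (rule arg_cong)
    then show False by simp
  qed
  have "(1 - ?X) * (1 - ?X ^ 3) / (1 - ?X) ^ 2 = 1 + ?X + ?X ^ 2"
    unfolding cube[symmetric] using nz by (simp add: power2_eq_square mult.assoc[symmetric])
  moreover have "(\<Prod>j<2. 1 - ?X ^ degs j) = (1 - ?X) * (1 - ?X ^ 3)"
    by (simp add: numeral_2_eq_2 degs_def)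
  ultimately show "ci_hilbert 2 degs {..<2} 2 = 1"
    by (simp add: ci_hilbert_def)
  \<comment> \<open>Only one factor \<open>1 - X\<close> would cancel now, so the denominator is
    inverted as a power series.\<close>
  have "(1 - ?X ^ 3) / (1 - ?X) ^ 2 = (1 - ?X ^ 3) * inverse ((1 - ?X) ^ 2)"
    by (rule fps_divide_unit) simp
  also have "inverse ((1 - ?X) ^ 2) = Abs_fps (\<lambda>n. of_nat (n + 1))"
    by (rule fps_one_over_one_minus_fps_X_squared)
  finally have "(1 - ?X ^ 3) / (1 - ?X) ^ 2 = (1 - ?X ^ 3) * Abs_fps (\<lambda>n. of_nat (n + 1))" .
  moreover have "fps_nth ((1 - ?X ^ 3) * Abs_fps (\<lambda>n. of_nat (n + 1))) 1 = 2"
    by (simp add: fps_mult_nth One_nat_def)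
  moreover have "{..<2} - {0} = {1::nat}" by auto
  ultimately show "ci_hilbert 2 degs ({..<2} - {0}) 1 = 2"
    by (simp add: ci_hilbert_def degs_def)
qed

lemma ci_hilbert_neg: "t < 0 \<Longrightarrow> ci_hilbert n e J t = 0"
  by (simp add: ci_hilbert_def)

section \<open>Specialization to the rationals\<close>

lemma poly_mapping_decompose:
  "p = (\<Sum>m\<in>Poly_Mapping.keys p. Poly_Mapping.single m (Poly_Mapping.lookup p m))"
  by (rule poly_mapping_eqI) (simp add: lookup_sum lookup_single when_def in_keys_iff)

text \<open>\<open>kill_vars_except v\<close> sends the variable \<open>v\<close> to 1 and all others to 0.\<close>

definition kill_vars_except :: "'v \<Rightarrow> (('v \<Rightarrow>\<^sub>0 nat) \<Rightarrow>\<^sub>0 int) \<Rightarrow> rat" where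
  "kill_vars_except v p = (\<Sum>m\<in>{m \<in> Poly_Mapping.keys p. Poly_Mapping.keys m \<subseteq> {v}}. of_int (Poly_Mapping.lookup p m))"

text \<open>Lets two polynomials and their sum be evaluated over a common index set, although
  cancellation may shrink the keys of the sum.\<close>

lemma kill_vars_except_superset:
  assumes "finite A" "Poly_Mapping.keys p \<subseteq> A"
  shows "kill_vars_except v p =
    (\<Sum>m\<in>A. if Poly_Mapping.keys m \<subseteq> {v} then of_int (Poly_Mapping.lookup p m) else 0)"
  unfolding kill_vars_except_def sum.inter_filter[OF finite_keys]
  using assms by (intro sum.mono_neutral_left) (auto simp: in_keys_iff)

lemma kill_vars_except_add: "kill_vars_except v (p + q) = kill_vars_except v p + kill_vars_except v q"
proof -
  let ?A = "Poly_Mapping.keys p \<union> Poly_Mapping.keys q"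
  have "kill_vars_except v (p + q) =
      (\<Sum>m\<in>?A. if Poly_Mapping.keys m \<subseteq> {v} then of_int (Poly_Mapping.lookup (p + q) m) else 0)"
    by (rule kill_vars_except_superset) (use keys_add[of p q] in auto)
  then show ?thesis
    unfolding kill_vars_except_superset[of ?A p, simplified] kill_vars_except_superset[of ?A q, simplified]
    by (auto simp: lookup_add simp flip: sum.distrib intro: sum.cong)
qed

lemma kill_vars_except_single:
  "kill_vars_except v (Poly_Mapping.single m c) = (if Poly_Mapping.keys m \<subseteq> {v} then of_int c else 0)"
  by (subst kill_vars_except_superset[of "{m}"]) auto

lemma kill_vars_except_sum:
  "kill_vars_except v (sum f A) = (\<Sum>x\<in>A. kill_vars_except v (f x))"
  by (induction A rule: infinite_finite_induct)
    (auto simp: kill_vars_except_add, auto simp: kill_vars_except_def)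

text \<open>By bilinearity it suffices to compare products of single terms. Natural exponents cannot
  cancel, so a product of monomials survives exactly if both factors do.\<close>

lemma kill_vars_except_mult: "kill_vars_except v (p * q) = kill_vars_except v p * kill_vars_except v q"
proof -
  have keys_sum: "Poly_Mapping.keys (m + m') = Poly_Mapping.keys m \<union> Poly_Mapping.keys m'"
    for m m' :: "'a \<Rightarrow>\<^sub>0 nat"
    by (auto simp: in_keys_iff lookup_add)
  let ?s = "\<lambda>p m. Poly_Mapping.single m (Poly_Mapping.lookup p m)"
  have "p * q = (\<Sum>m\<in>Poly_Mapping.keys p. ?s p m) * (\<Sum>m'\<in>Poly_Mapping.keys q. ?s q m')"
    using poly_mapping_decompose[of p] poly_mapping_decompose[of q] by simp
  also have "kill_vars_except v \<dots> = (\<Sum>m\<in>Poly_Mapping.keys p. \<Sum>m'\<in>Poly_Mapping.keys q.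
      kill_vars_except v (?s p m) * kill_vars_except v (?s q m'))"
    unfolding sum_product kill_vars_except_sum mult_single kill_vars_except_single keys_sum
    by (intro sum.cong refl) auto
  also have "\<dots> = kill_vars_except v (\<Sum>m\<in>Poly_Mapping.keys p. ?s p m)
      * kill_vars_except v (\<Sum>m'\<in>Poly_Mapping.keys q. ?s q m')"
    unfolding kill_vars_except_sum sum_product ..
  finally show ?thesis
    unfolding poly_mapping_decompose[symmetric] .
qed

section \<open>The field of rationals and its copy inside an infinite type\<close>

definition rat_ring :: "rat ring" where
  "rat_ring = \<lparr>carrier = UNIV, monoid.mult = (*), one = 1, ring.zero = 0, add = (+)\<rparr>"

lemma field_rat_ring: "field rat_ring"
proof -
  have "cring rat_ring"
  proof (rule cringI)
    show "abelian_group rat_ring"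
    proof (rule abelian_groupI)
      fix x :: rat
      show "\<exists>y\<in>carrier rat_ring. y \<oplus>\<^bsub>rat_ring\<^esub> x = \<zero>\<^bsub>rat_ring\<^esub>"
        by (rule bexI[of _ "- x"]) (simp_all add: rat_ring_def)
    qed (auto simp: rat_ring_def)
    show "comm_monoid rat_ring"
      by (rule comm_monoidI) (auto simp: rat_ring_def)
  qed (auto simp: rat_ring_def algebra_simps)
  moreover have "\<exists>y. y * x = 1 \<and> x * y = 1" if "x \<noteq> 0" for x :: rat
    using that by (intro exI[of _ "inverse x"]) simp
  then have "Units rat_ring = carrier rat_ring - {\<zero>\<^bsub>rat_ring\<^esub>}"
    by (auto simp: rat_ring_def Units_def)
  ultimately show ?thesis
    by (rule cring.cring_fieldI)
qed

text \<open>The universal property speaks only of fields with carrier in \<open>'k\<close>, so the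
  rationals must be moved there. They are countable, hence inject into any infinite type.\<close>

lemma ex_rat_ring_iso:
  assumes "infinite (UNIV :: 'k set)"
  obtains K :: "'k ring" and h where "field K" "h \<in> ring_iso rat_ring K" "h 0 = \<zero>\<^bsub>K\<^esub>"
proof -
  obtain f :: "nat \<Rightarrow> 'k" where "inj f"
    using infinite_countable_subset[OF assms] by auto
  define h where "h = f \<circ> (to_nat :: rat \<Rightarrow> nat)"
  have h: "inj h"
    unfolding h_def using \<open>inj f\<close> by (simp add: inj_compose)
  define K :: "'k ring" where
    "K = \<lparr>carrier = range h, monoid.mult = (\<lambda>x y. h (the_inv h x * the_inv h y)), one = h 1,
      ring.zero = h 0, add = (\<lambda>x y. h (the_inv h x + the_inv h y))\<rparr>"
  have iso: "h \<in> ring_iso rat_ring K"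
    using h by (auto simp: the_inv_f_f ring_iso_def ring_hom_def rat_ring_def K_def bij_betw_def)
  \<comment> \<open>The transfer of the field axioms along \<open>iso\<close> yields a record whose
    zero is reset to the image of zero; \<open>K\<close> has that zero already.\<close>
  have "K\<lparr>ring.zero := h \<zero>\<^bsub>rat_ring\<^esub>\<rparr> = K"
    by (simp add: K_def rat_ring_def)
  then have "field K"
    using field.ring_iso_imp_img_field[OF field_rat_ring iso] by simp
  then show ?thesis
    using iso by (rule that) (simp add: K_def)
qed

section \<open>Divisibility of the subresultants\<close>

text \<open>The exponent vector of a single coefficient of \<open>P_0\<close>: of \<open>a\<close>
  for \<open>j = 0\<close> and of \<open>b\<close> for \<open>j = 1\<close>.\<close>

abbreviation lin_form_var :: "nat \<Rightarrow> nat \<times> exponent \<Rightarrow>\<^sub>0 nat" where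
  "lin_form_var j \<equiv> Poly_Mapping.single (0, xvar j) 1"

text \<open>Degree zero in the coefficients of \<open>P_1\<close> leaves only the variables
  \<open>a\<close> and \<open>b\<close>, whose monomials of degree two are \<open>a^2\<close>,
  \<open>a b\<close> and \<open>b^2\<close>.\<close>

lemma index_exponent_cases:
  assumes "Poly_Mapping.keys m \<subseteq> coeff_indices 2 degs"
    and "(\<Sum>v\<in>{v \<in> Poly_Mapping.keys m. fst v = 0}. Poly_Mapping.lookup m v) = 2"
    and "(\<Sum>v\<in>{v \<in> Poly_Mapping.keys m. fst v = 1}. Poly_Mapping.lookup m v) = 0"
  shows "m \<in> {lin_form_var 0 + lin_form_var 0, lin_form_var 0 + lin_form_var 1, lin_form_var 1 + lin_form_var 1}"
proof -
  let ?V = "{(0, xvar 0), (0, xvar 1)}" and ?l = "Poly_Mapping.lookup m"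
  \<comment> \<open>Exponents at keys are positive, so a vanishing sum means that there are no such
    keys.\<close>
  have "{v \<in> Poly_Mapping.keys m. fst v = 1} = {}"
    using assms(3) by (subst (asm) sum_eq_0_iff) (auto simp: in_keys_iff)
  then have V: "Poly_Mapping.keys m \<subseteq> ?V"
    using assms(1) monomials_1 by (force simp: coeff_indices_def degs_def less_2_cases_iff)
  then have "{v \<in> Poly_Mapping.keys m. fst v = 0} = Poly_Mapping.keys m" by auto
  then have "(\<Sum>v\<in>?V. ?l v) = 2"
    using assms(2) sum.mono_neutral_left[of ?V "Poly_Mapping.keys m" ?l] V by (auto simp: in_keys_iff)
  then have sum: "?l (0, xvar 0) + ?l (0, xvar 1) = 2"
    using xvar_sums_distinct(1) by simp
  have m: "m = Poly_Mapping.single (0, xvar 0) (?l (0, xvar 0)) + Poly_Mapping.single (0, xvar 1) (?l (0, xvar 1))"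
  proof (rule poly_mapping_eqI)
    fix v
    show "?l v = Poly_Mapping.lookup (Poly_Mapping.single (0, xvar 0) (?l (0, xvar 0))
        + Poly_Mapping.single (0, xvar 1) (?l (0, xvar 1))) v"
      using V xvar_sums_distinct(1)
      by (cases "v \<in> ?V") (auto simp: lookup_add lookup_single when_def in_keys_iff)
  qed
  from sum consider "?l (0, xvar 0) = 2" "?l (0, xvar 1) = 0" | "?l (0, xvar 0) = 1" "?l (0, xvar 1) = 1"
    | "?l (0, xvar 0) = 0" "?l (0, xvar 1) = 2" by linarith
  then show ?thesis
    by cases (use m in \<open>simp_all flip: single_add\<close>)
qed

lemma coeff_var_lin_form: "coeff_var 0 (xvar j) = Poly_Mapping.single (lin_form_var j) 1"
  by (simp add: coeff_var_def)

lemma coeff_var_lin_form_in_coeff_ring: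
  assumes "j < 2"
  shows "coeff_var 0 (xvar j) \<in> carrier (coeff_ring 2 degs)"
proof (rule coeff_var_in_coeff_ring)
  show "xvar j \<in> monomials 2 (degs 0)"
  proof -
    have "j = 0 \<or> j = 1" using assms by auto
    then show ?thesis by (auto simp: degs_def monomials_1)
  qed
qed simp

lemma lin_form_var_sums_distinct:
  "lin_form_var 0 + lin_form_var 0 \<noteq> lin_form_var 0 + lin_form_var 1"
  "lin_form_var 0 + lin_form_var 0 \<noteq> lin_form_var 1 + lin_form_var 1"
  "lin_form_var 0 + lin_form_var 1 \<noteq> lin_form_var 1 + lin_form_var 1"
  using xvar_sums_distinct(1)
  by (auto simp: poly_mapping_eq_iff fun_eq_iff lookup_add lookup_single when_def
      intro!: exI[of _ "(0, xvar 0)"])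

text \<open>A field has no zero divisors, so \<open>b^2\<close> is nonzero exactly when
  \<open>b\<close> is. The square, and not \<open>b\<close> itself, has the prescribed degree 2 in
  the coefficients of \<open>P_0\<close>.\<close>

lemma square_is_subresultant:
  "is_subresultant TYPE('k) 2 degs 2 {xvar 0 + xvar 0} (coeff_var 0 (xvar 1) * coeff_var 0 (xvar 1))"
  unfolding is_subresultant_def
proof (intro conjI allI impI)
  let ?b = "coeff_var 0 (xvar 1)"
  have b: "?b \<in> carrier (coeff_ring 2 degs)"
    by (rule coeff_var_lin_form_in_coeff_ring) simp
  have sq: "?b * ?b = Poly_Mapping.single (Poly_Mapping.single (0, xvar 1) 2) 1"
    by (simp add: coeff_var_def mult_single flip: single_add)
  show "?b * ?b \<in> carrier (coeff_ring 2 degs)"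
    using b unfolding sq by (simp add: coeff_ring_def coeff_var_def)
  fix i :: nat assume "i < 2"
  have "{v. v = (0, xvar 1) \<and> fst v = i} = (if i = 0 then {(0, xvar 1)} else {})"
    by auto
  then show "homogeneous_in i (ci_hilbert 2 degs ({..<2} - {i}) (int 2 - int (degs i))) (?b * ?b)"
    using \<open>i < 2\<close> ci_hilbert_degs(2)
    by (auto simp: sq homogeneous_in_def less_2_cases_iff degs_def ci_hilbert_neg)
next
  fix K :: "'k ring" and \<phi>
  let ?b = "coeff_var 0 (xvar 1)"
  assume K: "field K" and \<phi>: "\<phi> \<in> ring_hom (coeff_ring 2 degs) K"
  interpret field K by fact
  have b: "?b \<in> carrier (coeff_ring 2 degs)"
    by (rule coeff_var_lin_form_in_coeff_ring) simp
  have "\<phi> (?b * ?b) = \<phi> ?b \<otimes>\<^bsub>K\<^esub> \<phi> ?b"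
    using ring_hom_mult[OF \<phi> b b] by (simp add: coeff_ring_def)
  then have "\<phi> (?b * ?b) \<noteq> \<zero>\<^bsub>K\<^esub> \<longleftrightarrow> \<phi> ?b \<noteq> \<zero>\<^bsub>K\<^esub>"
    using integral_iff ring_hom_closed[OF \<phi> b] by simp
  then show "\<phi> (?b * ?b) \<noteq> \<zero>\<^bsub>K\<^esub> \<longleftrightarrow>
      set_add (mpoly_ring K 2) (spec_ideal K 2 degs \<phi> \<inter> degree_part K 2 2)
        (monomial_span K {xvar 0 + xvar 0}) = degree_part K 2 2"
    using spec_ideal_complement_iff[OF K \<phi>] by simp
qed

text \<open>Uses the homogeneity degrees 2 and 0; the rational equations pass to natural numbers by
  injectivity of \<open>of_nat\<close>.\<close>

lemma subresultant_keys:
  assumes "is_subresultant TYPE('k) 2 degs 2 S \<Delta>" "m \<in> Poly_Mapping.keys \<Delta>"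
  shows "m \<in> {lin_form_var 0 + lin_form_var 0, lin_form_var 0 + lin_form_var 1, lin_form_var 1 + lin_form_var 1}"
proof (rule index_exponent_cases)
  have hom: "homogeneous_in i (ci_hilbert 2 degs ({..<2} - {i}) (int 2 - int (degs i))) \<Delta>" if "i < 2" for i
    using assms(1) that by (simp add: is_subresultant_def)
  show "Poly_Mapping.keys m \<subseteq> coeff_indices 2 degs"
    using assms by (auto simp: is_subresultant_def coeff_ring_def)
  have "(of_nat (\<Sum>v\<in>{v \<in> Poly_Mapping.keys m. fst v = 0}. Poly_Mapping.lookup m v) :: rat) = of_nat 2"
    using hom[of 0] assms(2) ci_hilbert_degs(2) unfolding homogeneous_in_def by (simp add: degs_def)
  then show "(\<Sum>v\<in>{v \<in> Poly_Mapping.keys m. fst v = 0}. Poly_Mapping.lookup m v) = 2"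
    by (simp only: of_nat_eq_iff)
  have "(of_nat (\<Sum>v\<in>{v \<in> Poly_Mapping.keys m. fst v = 1}. Poly_Mapping.lookup m v) :: rat) = of_nat 0"
    using hom[of 1] assms(2) unfolding homogeneous_in_def by (simp add: degs_def ci_hilbert_neg)
  then show "(\<Sum>v\<in>{v \<in> Poly_Mapping.keys m. fst v = 1}. Poly_Mapping.lookup m v) = 0"
    by (simp only: of_nat_eq_iff)
qed

text \<open>Specializing \<open>a\<close> to 1 and all other variables to 0 makes \<open>b\<close>
  vanish, so the complement condition fails and \<Delta> must specialize to zero. That value is the
  coefficient of \<open>a^2\<close>.\<close>

lemma subresultant_lookup_zero:
  assumes "infinite (UNIV :: 'k set)"
    and \<Delta>: "is_subresultant TYPE('k) 2 degs 2 {xvar 0 + xvar 0} \<Delta>"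
  shows "Poly_Mapping.lookup \<Delta> (lin_form_var 0 + lin_form_var 0) = 0"
proof -
  obtain K :: "'k ring" and h where K: "field K" and h: "h \<in> ring_iso rat_ring K" "h 0 = \<zero>\<^bsub>K\<^esub>"
    using ex_rat_ring_iso[OF assms(1)] .
  let ?E = "kill_vars_except (0, xvar 0)" and ?aa = "lin_form_var 0 + lin_form_var 0"
  \<comment> \<open>The instance with exponent 0 and coefficient 1 gives preservation of the
    unit.\<close>
  have E_hom: "?E \<in> ring_hom (coeff_ring 2 degs) rat_ring"
    using kill_vars_except_single[of "(0, xvar 0)" 0 1]
    by (intro ring_hom_memI) (auto simp: coeff_ring_def rat_ring_def kill_vars_except_mult kill_vars_except_add)
  have hE: "h \<circ> ?E \<in> ring_hom (coeff_ring 2 degs) K"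
    using h(1) by (intro ring_hom_trans[OF E_hom]) (simp add: ring_iso_def)
  have "?E (coeff_var 0 (xvar 1)) = 0"
    using xvar_sums_distinct(1) by (simp add: coeff_var_def kill_vars_except_single)
  then have "(h \<circ> ?E) (coeff_var 0 (xvar 1)) = \<zero>\<^bsub>K\<^esub>"
    using h(2) by simp
  then have "(h \<circ> ?E) \<Delta> = \<zero>\<^bsub>K\<^esub>"
    using spec_ideal_complement_iff[OF K hE] \<Delta> K hE unfolding is_subresultant_def by blast
  \<comment> \<open>Injectivity carries the vanishing back from \<open>K\<close> to the rationals,
    where it can be read as a statement about an integer.\<close>
  moreover have "inj h"
    using h(1) by (auto simp: ring_iso_def bij_betw_def rat_ring_def)
  ultimately have "?E \<Delta> = 0"
    using h(2) by (metis comp_apply injD)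
  moreover have "?E \<Delta> = of_int (Poly_Mapping.lookup \<Delta> ?aa)"
  proof -
    let ?M = "{?aa, lin_form_var 0 + lin_form_var 1, lin_form_var 1 + lin_form_var 1}"
    have "?E \<Delta> = (\<Sum>m\<in>?M. if Poly_Mapping.keys m \<subseteq> {(0, xvar 0)} then of_int (Poly_Mapping.lookup \<Delta> m) else 0)"
      using subresultant_keys[OF \<Delta>] by (intro kill_vars_except_superset) auto
    also have "\<dots> = (\<Sum>m\<in>{?aa}. of_int (Poly_Mapping.lookup \<Delta> m))"
    proof (rule sum.mono_neutral_cong_right)
      \<comment> \<open>The monomials \<open>a b\<close> and \<open>b^2\<close> contain
        \<open>b\<close> and are sent to zero.\<close>
      have "\<not> Poly_Mapping.keys (lin_form_var i + lin_form_var 1) \<subseteq> {(0, xvar 0)}" for i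
      proof
        assume sub: "Poly_Mapping.keys (lin_form_var i + lin_form_var 1) \<subseteq> {(0, xvar 0)}"
        have "(0, xvar 1) \<in> Poly_Mapping.keys (lin_form_var i + lin_form_var 1)"
          by (simp add: in_keys_iff lookup_add lookup_single)
        from subsetD[OF sub this] show False
          using xvar_sums_distinct(1) by simp
      qed
      then show "\<forall>m\<in>?M - {?aa}. (if Poly_Mapping.keys m \<subseteq> {(0, xvar 0)}
          then of_int (Poly_Mapping.lookup \<Delta> m) else 0) = (0 :: rat)"
        by (auto simp del: keys_single)
    qed (use keys_add[of "lin_form_var 0" "lin_form_var 0"] in auto)
    finally show ?thesis by simp
  qed
  ultimately show ?thesis by simp
qed

text \<open>The variable \<open>b\<close> divides \<Delta> without being associated to it, and it is
  not a unit. An irreducible element has only units as proper factors.\<close>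

lemma subresultant_reducible:
  assumes "infinite (UNIV :: 'k set)"
    and \<Delta>: "is_subresultant TYPE('k) 2 degs 2 {xvar 0 + xvar 0} \<Delta>"
  shows "\<not> ring_irreducible\<^bsub>coeff_ring 2 degs\<^esub> \<Delta>"
proof
  assume irr: "ring_irreducible\<^bsub>coeff_ring 2 degs\<^esub> \<Delta>"
  let ?A = "coeff_ring 2 degs" and ?b = "coeff_var 0 (xvar 1)"
  let ?ab = "lin_form_var 0 + lin_form_var 1" and ?bb = "lin_form_var 1 + lin_form_var 1"
  let ?l = "Poly_Mapping.lookup \<Delta>"
  \<comment> \<open>The cofactor: dividing \<open>q a b + r b^2\<close> by \<open>b\<close> leaves
    \<open>q a + r b\<close>.\<close>
  define c where "c = Poly_Mapping.single (lin_form_var 0) (?l ?ab) + Poly_Mapping.single (lin_form_var 1) (?l ?bb)"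
  have b: "?b \<in> carrier ?A" and a: "coeff_var 0 (xvar 0) \<in> carrier ?A"
    by (simp_all add: coeff_var_lin_form_in_coeff_ring)
  have keys_\<Delta>: "m \<in> {?ab, ?bb}" if "m \<in> Poly_Mapping.keys \<Delta>" for m
    using subresultant_keys[OF \<Delta> that] subresultant_lookup_zero[OF assms] that
    by (auto simp: in_keys_iff)
  have "?b * c = Poly_Mapping.single ?ab (?l ?ab) + Poly_Mapping.single ?bb (?l ?bb)"
    by (simp add: c_def coeff_var_lin_form distrib_left mult_single add.commute)
  also have "\<dots> = \<Delta>"
  proof (rule poly_mapping_eqI)
    fix m
    show "Poly_Mapping.lookup (Poly_Mapping.single ?ab (?l ?ab) + Poly_Mapping.single ?bb (?l ?bb)) m = ?l m"
      using keys_\<Delta>[of m] lin_form_var_sums_distinct(3)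
      by (auto simp: lookup_add lookup_single when_def in_keys_iff)
  qed
  finally have "\<Delta> = ?b * c" ..
  moreover have "c \<in> carrier ?A"
    using a b keys_add[of "Poly_Mapping.single (lin_form_var 0) (?l ?ab)" "Poly_Mapping.single (lin_form_var 1) (?l ?bb)"]
    by (fastforce simp: c_def coeff_ring_def coeff_var_def split: if_splits)
  ultimately have "?b divides\<^bsub>?A\<^esub> \<Delta>"
    by (auto simp: factor_def coeff_ring_def)
  \<comment> \<open>Every monomial of a multiple of \<Delta> is a multiple of \<open>a b\<close> or
    \<open>b^2\<close>, and neither of these divides \<open>b\<close>.\<close>
  moreover have "\<not> \<Delta> divides\<^bsub>?A\<^esub> ?b"
  proof
    assume "\<Delta> divides\<^bsub>?A\<^esub> ?b"
    then obtain s where "?b = \<Delta> * s"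
      by (auto simp: factor_def coeff_ring_def)
    then have "lin_form_var 1 \<in> Poly_Mapping.keys (\<Delta> * s)"
      by (simp add: coeff_var_lin_form flip: \<open>?b = \<Delta> * s\<close>)
    then obtain m m' where "m \<in> {?ab, ?bb}" "lin_form_var 1 = m + m'"
      using keys_mult[of \<Delta> s] keys_\<Delta> by blast
    from \<open>m \<in> {?ab, ?bb}\<close> show False
    proof
      assume "m = ?ab"
      then show False
        using arg_cong[OF \<open>lin_form_var 1 = m + m'\<close>, of "\<lambda>m. Poly_Mapping.lookup m (0, xvar 0)"]
          xvar_sums_distinct(1) by (auto simp: lookup_add lookup_single when_def)
    next
      assume "m \<in> {?bb}"
      then show False
        using arg_cong[OF \<open>lin_form_var 1 = m + m'\<close>, of "\<lambda>m. Poly_Mapping.lookup m (0, xvar 1)"]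
        by (auto simp: lookup_add lookup_single when_def)
    qed
  qed
  ultimately have "properfactor ?A ?b \<Delta>"
    by (simp add: properfactor_def)
  then have "?b \<in> Units ?A"
    using irr b by (auto simp: ring_irreducible_def irreducible_def)
  then obtain s where "?b * s = 1"
    by (auto simp: Units_def coeff_ring_def)
  \<comment> \<open>The constant monomial of 1 would have to occur in a multiple of
    \<open>b\<close>, all of whose monomials contain \<open>b\<close>.\<close>
  then have "0 \<in> Poly_Mapping.keys (?b * s)"
    by simp
  then obtain m' where "0 = lin_form_var 1 + m'"
    using keys_mult[of ?b s] by (auto simp: coeff_var_lin_form)
  from arg_cong[OF this, of "\<lambda>m. Poly_Mapping.lookup m (0, xvar 1)"] show False
    by (simp add: lookup_add lookup_single)
qed

text \<open>Irreducibility is refuted for every \<Delta> with the defining degrees and universal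
  property, so no uniqueness up to sign is presupposed. The existence clause, witnessed by
  \<open>b^2\<close>, keeps this from being vacuous.\<close>

theorem mainTheorem2:
  assumes "infinite (UNIV :: 'k set)"
  shows "\<exists>(n::nat) (d :: nat \<Rightarrow> nat) (\<nu>::nat) (S :: exponent set).
    n \<ge> 2 \<and> (\<forall>i<n. d i \<ge> 1) \<and>
    int \<nu> = (\<Sum>i<n. (int (d i) - 1)) - int (Min (d ` {..<n})) + 1 \<and>
    S \<subseteq> monomials n \<nu> \<and> of_nat (card S) = ci_hilbert n d {..<n} (int \<nu>) \<and>
    (\<exists>\<Delta>. is_subresultant TYPE('k) n d \<nu> S \<Delta>) \<and>
    (\<forall>\<Delta>. is_subresultant TYPE('k) n d \<nu> S \<Delta> \<longrightarrow>
       \<not> ring_irreducible\<^bsub>coeff_ring n d\<^esub> \<Delta>)"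
proof (intro exI conjI)
  have lt: "{..<2} = {0, 1::nat}" by auto
  show "int 2 = (\<Sum>i<2. (int (degs i) - 1)) - int (Min (degs ` {..<2})) + 1"
    by (simp add: lt degs_def)
  show "{xvar 0 + xvar 0} \<subseteq> monomials 2 2"
    by (simp add: monomials_2)
  show "of_nat (card {xvar 0 + xvar 0}) = ci_hilbert 2 degs {..<2} (int 2)"
    by (simp add: ci_hilbert_degs(1))
  show "is_subresultant TYPE('k) 2 degs 2 {xvar 0 + xvar 0} (coeff_var 0 (xvar 1) * coeff_var 0 (xvar 1))"
    by (rule square_is_subresultant)
  show "\<forall>\<Delta>. is_subresultant TYPE('k) 2 degs 2 {xvar 0 + xvar 0} \<Delta> \<longrightarrow>
       \<not> ring_irreducible\<^bsub>coeff_ring 2 degs\<^esub> \<Delta>"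
    using subresultant_reducible[OF assms] by blast
qed (simp_all add: degs_def)

end
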